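(* Let $0\le r_1\le r_2\le\infty$. Then there is a dense set of irrational $\theta\in(0,1)$ such that the set of accumulation points in $[0,\infty]$ of the sequence $$\left\{\frac{M_n(0)}{|m_n(0)|}\right\}_{n\ge2}$$ is the interval $[r_1,r_2]$.
   Context: Let $f=\chi_{[0,1/2)}-\chi_{[1/2,1)}$ on $[0,1)$ (addition modulo one). For irrational $\theta$ and $x\in[0,1)$ put $S_n(x)=\sum_{i=0}^{n-1}f(x+i\theta)$, and for $n\ge2$ put $M_n(x)=\max\{S_i(x):i=1,\dots,n-1\}$ and $m_n(x)=\min\{S_i(x):i=1,\dots,n-1\}$. Note $M_n(0)\ge S_1(0)=1$; convention: $p/0=\infty$ for positive $p$. *)

theory Defs
  imports "HOL-Analysis.Analysis"
begin

definition half_step :: "real \<Rightarrow> real" where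
  "half_step x = indicator {0..<1/2} x - indicator {1/2..<1} x"

text \<open>Addition modulo one on \<open>[0,1)\<close> is expressed by \<^const>\<open>frac\<close>.\<close>

definition rot_sum :: "real \<Rightarrow> nat \<Rightarrow> real \<Rightarrow> real" where
  "rot_sum \<theta> n x = (\<Sum>i<n. half_step (frac (x + real i * \<theta>)))"

text \<open>The next two are meaningful only for \<open>n \<ge> 2\<close>, where the index set is nonempty.\<close>

definition rot_max :: "real \<Rightarrow> nat \<Rightarrow> real \<Rightarrow> real" where
  "rot_max \<theta> n x = Max ((\<lambda>i. rot_sum \<theta> i x) ` {1..<n})"

definition rot_min :: "real \<Rightarrow> nat \<Rightarrow> real \<Rightarrow> real" where
  "rot_min \<theta> n x = Min ((\<lambda>i. rot_sum \<theta> i x) ` {1..<n})"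

text \<open>Division in \<^typ>\<open>ennreal\<close> satisfies \<open>p / 0 = \<infinity>\<close> for \<open>p > 0\<close>. For \<open>n \<ge> 2\<close> the
  numerator is at least \<open>rot_sum \<theta> 1 0 = 1\<close>, so the truncation of negative reals by
  \<^const>\<open>ennreal\<close> has no effect.\<close>

definition max_min_ratio :: "real \<Rightarrow> nat \<Rightarrow> ennreal" where
  "max_min_ratio \<theta> n = ennreal (rot_max \<theta> n 0) / ennreal \<bar>rot_min \<theta> n 0\<bar>"

text \<open>Accumulation points of a sequence, as opposed to limit points of its range: every
  neighbourhood contains \<open>u n\<close> for infinitely many indices \<open>n\<close>. Finitely many
  initial terms are irrelevant.\<close>

definition seq_accumulation_points :: "(nat \<Rightarrow> 'a::topological_space) \<Rightarrow> 'a set" where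
  "seq_accumulation_points u =
     {l. \<forall>U. open U \<and> l \<in> U \<longrightarrow> infinite {n. u n \<in> U}}"

end

theory Submission
  imports Defs
begin

text \<open>With \<open>\<alpha> = 2 \<theta>\<close> the sums are \<open>S\<^sub>n = \<Sum>\<^sub>i\<^sub><\<^sub>n (-1)\<^bsup>\<lfloor>i \<alpha>\<rfloor>\<^esup>\<close>. Let \<open>\<alpha>\<close> lie between Farey
  neighbours \<open>P/Q\<close> with \<open>P\<close> odd and \<open>P'/Q'\<close> with \<open>P'\<close> even. A shift of time by \<open>Q'\<close> preserves the
  increments and one by \<open>Q\<close> negates them. Let \<open>M\<close> and \<open>m\<close> be the maximum and minimum of \<open>S\<close> up
  to time \<open>Q\<close>. If \<open>S\<^sub>Q = M + m - 1\<close> (and the sums up to \<open>Q'\<close> are under control), then replacing \<open>P/Q\<close>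
  by the mediant increases \<open>M\<close> by one and keeps \<open>m\<close> when the even fraction is on the left, and
  decreases \<open>m\<close> by one and keeps \<open>M\<close> when it is on the right. Moreover \<open>\<alpha>\<close> can be chosen
  such that the even fraction stays on its side or such that it changes sides. Hence \<open>(M, \<bar>m\<bar>)\<close>
  can be made to follow any lattice path that turns infinitely often, and it remains to choose a
  path whose slopes oscillate between approximations of \<open>r1\<close> and \<open>r2\<close>.\<close>

section \<open>The walk between Farey neighbours\<close>

definition walk :: "real \<Rightarrow> nat \<Rightarrow> int" where
  "walk \<alpha> n = (\<Sum>i<n. if even \<lfloor>real i * \<alpha>\<rfloor> then 1 else -1)"

text \<open>Doubling turns the two halves of the circle into unit intervals: the floor of
  \<open>2 * z\<close> is even exactly when the fractional part of \<open>z\<close> lies in the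
  first half.\<close>

lemma half_step_frac: "half_step (frac z) = (if even \<lfloor>2 * z\<rfloor> then 1 else -1)"
proof -
  have r: "0 \<le> frac z" "frac z < 1" by (auto simp: frac_lt_1)
  have z: "2 * z = of_int (2 * \<lfloor>z\<rfloor>) + 2 * frac z" by (simp add: frac_def)
  have fl: "\<lfloor>2 * z\<rfloor> = 2 * \<lfloor>z\<rfloor> + \<lfloor>2 * frac z\<rfloor>"
    by (subst z) (rule int_add_floor[symmetric])
  show ?thesis
  proof (cases "frac z < 1/2")
    case True
    then have "\<lfloor>2 * frac z\<rfloor> = 0" using r by (simp add: floor_eq_iff)
    then show ?thesis using True r fl by (simp add: half_step_def indicator_def)
  next
    case False
    then have "\<lfloor>2 * frac z\<rfloor> = 1" using r by (simp add: floor_eq_iff)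
    then show ?thesis using False r fl by (simp add: half_step_def indicator_def)
  qed
qed

lemma rot_sum_eq_walk: "rot_sum \<theta> n 0 = of_int (walk (2 * \<theta>) n)"
  unfolding rot_sum_def walk_def of_int_sum
  by (intro sum.cong) (auto simp: half_step_frac mult.left_commute)

lemma walk_1 [simp]: "walk \<alpha> (Suc 0) = 1"
  by (simp add: walk_def)

text \<open>Negating a noninteger flips the parity of its floor, so all terms change sign except the
  one at \<open>i = 0\<close>, which stays 1. This exception accounts for the constant 2.\<close>

lemma walk_uminus:
  assumes "n \<ge> 1" and nint: "\<And>i. 0 < i \<Longrightarrow> i < n \<Longrightarrow> real i * \<alpha> \<notin> \<int>"
  shows "walk (- \<alpha>) n = 2 - walk \<alpha> n"
proof -
  have "walk (- \<alpha>) (Suc k) = 2 - walk \<alpha> (Suc k)" if "Suc k \<le> n" for k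
    using that
  proof (induction k)
    case (Suc k)
    have "\<lfloor>- (real (Suc k) * \<alpha>)\<rfloor> = - \<lfloor>real (Suc k) * \<alpha>\<rfloor> - 1"
      using nint[of "Suc k"] Suc.prems
      by (metis Ints_of_int Suc_le_lessD diff_minus_eq_add floor_minus ceiling_altdef minus_diff_commute
          minus_add_distrib uminus_add_conv_diff zero_less_Suc add.commute)
    then have "even \<lfloor>real (Suc k) * - \<alpha>\<rfloor> \<longleftrightarrow> odd \<lfloor>real (Suc k) * \<alpha>\<rfloor>" by simp
    with Suc show ?case by (simp add: walk_def del: of_nat_Suc)
  qed simp
  from this[of "n - 1"] \<open>n \<ge> 1\<close> show ?thesis by simp
qed

text \<open>The fraction with even numerator is the left neighbour here; the opposite arrangement is
  treated by passing to \<open>- \<alpha>\<close>. Determinant one makes \<open>(Q, P)\<close> and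
  \<open>(Q', P')\<close> a basis of the integer lattice.\<close>

definition farey :: "real \<Rightarrow> int \<Rightarrow> nat \<Rightarrow> int \<Rightarrow> nat \<Rightarrow> bool" where
  "farey \<alpha> P Q P' Q' \<longleftrightarrow> odd P \<and> even P' \<and> 0 < Q \<and> 0 < Q' \<and> P * int Q' - P' * int Q = 1 \<and>
     of_int P' < real Q' * \<alpha> \<and> real Q * \<alpha> < of_int P"

context
  fixes \<alpha> :: real and P P' :: int and Q Q' :: nat
  assumes fy: "farey \<alpha> P Q P' Q'"
begin

text \<open>Coordinates in the unimodular basis. The deviation of \<open>c\<close> from
  \<open>i * \<alpha>\<close> becomes a combination of two positive gaps, so that its sign and size
  can be read off from \<open>a\<close> and \<open>b\<close>.\<close>

lemma farey_lattice:
  fixes i :: nat and c :: int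
  obtains a b :: int where "int i = a * int Q + b * int Q'" and "c = a * P + b * P'"
    and "of_int c - real i * \<alpha> = of_int a * (of_int P - real Q * \<alpha>) - of_int b * (real Q' * \<alpha> - of_int P')"
proof
  define a b where "a = c * int Q' - int i * P'" and "b = int i * P - c * int Q"
  have det: "P * int Q' - P' * int Q = 1" using fy by (simp add: farey_def)
  have "a * int Q + b * int Q' = int i * (P * int Q' - P' * int Q)"
    unfolding a_def b_def by (simp add: algebra_simps)
  then show i: "int i = a * int Q + b * int Q'" using det by simp
  have "a * P + b * P' = c * (P * int Q' - P' * int Q)"
    unfolding a_def b_def by (simp add: algebra_simps)
  then show c: "c = a * P + b * P'" using det by simp
  have "of_int c = of_int a * of_int P + of_int b * (of_int P' :: real)"
    by (subst c) simp
  moreover have "real i = of_int a * real Q + of_int b * real Q'"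
    using arg_cong[OF i, of real_of_int] by simp
  ultimately show "of_int c - real i * \<alpha> =
      of_int a * (of_int P - real Q * \<alpha>) - of_int b * (real Q' * \<alpha> - of_int P')"
    by (simp add: algebra_simps)
qed

text \<open>The shift adds \<open>P'\<close> and a small gap \<open>d' > 0\<close>, so no integer
  \<open>c\<close> may lie in the interval from \<open>i * \<alpha>\<close> (excluded) to
  \<open>i * \<alpha> + d'\<close>. For such a \<open>c\<close>, coordinate \<open>a \<ge> 1\<close>
  forces \<open>b < 0\<close> because of \<open>i < Q\<close>, and then the deviation is at least
  \<open>d + d'\<close>; coordinate \<open>a \<le> 0\<close> forces \<open>b < 0\<close> and a
  negative \<open>i\<close>.\<close>

lemma floor_shift_even:
  assumes "i < Q"
  shows "\<lfloor>real (Q' + i) * \<alpha>\<rfloor> = P' + \<lfloor>real i * \<alpha>\<rfloor>"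
proof -
  define d d' where "d = of_int P - real Q * \<alpha>" and "d' = real Q' * \<alpha> - of_int P'"
  have d: "d > 0" "d' > 0" using fy by (auto simp: farey_def d_def d'_def)
  define c where "c = \<lfloor>real i * \<alpha>\<rfloor> + 1"
  have "real i * \<alpha> < of_int c" unfolding c_def by linarith
  moreover have "real i * \<alpha> + d' < of_int c"
  proof (rule ccontr)
    assume "\<not> ?thesis"
    then have gap: "of_int c - real i * \<alpha> \<le> d'" by simp
    obtain a b where ab: "int i = a * int Q + b * int Q'"
      "of_int c - real i * \<alpha> = of_int a * d - of_int b * d'"
      using farey_lattice[of i c] unfolding d_def d'_def by blast
    show False
    proof (cases "a \<ge> 1")
      case True
      have "b < 0"
      proof (rule ccontr)
        assume "\<not> b < 0"
        then have "int Q \<le> a * int Q" "0 \<le> b * int Q'" using True fy by (auto simp: farey_def)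
        then show False using ab(1) assms by linarith
      qed
      then have "of_int (- b) * d' \<ge> 1 * d'" using d by (intro mult_right_mono) (auto simp flip: of_int_minus)
      moreover have "of_int a * d \<ge> 1 * d" using True d by (intro mult_right_mono) auto
      ultimately show False using ab gap d by simp
    next
      case False
      then have "of_int a * d \<le> 0" using d by (simp add: mult_nonpos_nonneg)
      then have "of_int b * d' < 0" using ab(2) \<open>real i * \<alpha> < of_int c\<close> by linarith
      then have "b < 0" using d by (simp add: mult_less_0_iff)
      then have "b * int Q' < 0" "a * int Q \<le> 0"
        using False fy by (auto simp: farey_def mult_less_0_iff mult_nonpos_nonneg)
      then show False using ab(1) by linarith
    qed
  qed
  moreover have "of_int \<lfloor>real i * \<alpha>\<rfloor> \<le> real i * \<alpha>" by simp
  moreover have "real (Q' + i) * \<alpha> = of_int P' + (real i * \<alpha> + d')"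
    by (simp add: d'_def algebra_simps)
  ultimately show ?thesis using d unfolding c_def floor_eq_iff of_int_add of_int_1 by linarith
qed

text \<open>The same lattice argument for a shift that adds \<open>P - d\<close>. Time 0 is excluded
  because \<open>0 * \<alpha>\<close> is an integer and the shift crosses it.\<close>

lemma floor_shift_odd:
  assumes "0 < i" "i < Q'"
  shows "\<lfloor>real (Q + i) * \<alpha>\<rfloor> = P + \<lfloor>real i * \<alpha>\<rfloor>"
proof -
  define d d' where "d = of_int P - real Q * \<alpha>" and "d' = real Q' * \<alpha> - of_int P'"
  have d: "d > 0" "d' > 0" using fy by (auto simp: farey_def d_def d'_def)
  define c where "c = \<lfloor>real i * \<alpha>\<rfloor>"
  have c1: "of_int c \<le> real i * \<alpha>" unfolding c_def by linarith
  moreover have "real i * \<alpha> - d \<ge> of_int c"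
  proof (rule ccontr)
    assume "\<not> ?thesis"
    then have gap: "of_int c - real i * \<alpha> > - d" by simp
    obtain a b where ab: "int i = a * int Q + b * int Q'"
      "of_int c - real i * \<alpha> = of_int a * d - of_int b * d'"
      using farey_lattice[of i c] unfolding d_def d'_def by blast
    show False
    proof (cases "b \<ge> 1")
      case True
      have "a < 0"
      proof (rule ccontr)
        assume "\<not> a < 0"
        then have "int Q' \<le> b * int Q'" "0 \<le> a * int Q" using True fy by (auto simp: farey_def)
        then show False using ab(1) assms by linarith
      qed
      then have "of_int (- a) * d \<ge> 1 * d" using d by (intro mult_right_mono) (auto simp flip: of_int_minus)
      moreover have "of_int b * d' \<ge> 1 * d'" using True d by (intro mult_right_mono) auto
      ultimately show False using ab gap d by simp
    next
      case False
      then have "of_int b * d' \<le> 0" using d by (simp add: mult_nonpos_nonneg)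
      then have "of_int a * d \<le> 0" using ab(2) c1 by linarith
      then have "a \<le> 0" using d by (simp add: mult_le_0_iff)
      then have "b * int Q' \<le> 0" "a * int Q \<le> 0"
        using False fy by (auto simp: farey_def mult_le_0_iff)
      then show False using ab(1) assms by linarith
    qed
  qed
  moreover have "real i * \<alpha> < of_int c + 1" unfolding c_def by linarith
  moreover have "real (Q + i) * \<alpha> = of_int P + (real i * \<alpha> - d)"
    by (simp add: d_def algebra_simps)
  ultimately show ?thesis using d unfolding c_def floor_eq_iff of_int_add of_int_1 by linarith
qed

text \<open>This is the excluded time 0. The determinant gives \<open>d * Q' + d' * Q = 1\<close>
  for the two gaps, hence \<open>d < 1\<close>.\<close>

lemma floor_odd_denominator: "\<lfloor>real Q * \<alpha>\<rfloor> = P - 1"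
proof -
  define d d' where "d = of_int P - real Q * \<alpha>" and "d' = real Q' * \<alpha> - of_int P'"
  have d: "d > 0" "d' > 0" using fy by (auto simp: farey_def d_def d'_def)
  have det: "P * int Q' - P' * int Q = 1" and pos: "Q > 0" "Q' > 0" using fy by (auto simp: farey_def)
  have "d * real Q' + d' * real Q = of_int (P * int Q' - P' * int Q)"
    by (simp add: d_def d'_def algebra_simps)
  then have "d * real Q' + d' * real Q = 1" using det by simp
  moreover have "d' * real Q > 0" using d pos by simp
  moreover have "d * 1 \<le> d * real Q'" using d pos by (intro mult_left_mono) auto
  ultimately have "d < 1" by simp
  then show ?thesis using d by (simp add: floor_eq_iff d_def)
qed

section \<open>Symmetries of the walk under shifts by the two denominators\<close>

text \<open>Shifting by \<open>Q\<close> negates every increment except the first: the floor at time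
  \<open>Q\<close> is the even number \<open>P - 1\<close>, so that increment is again 1. Hence the
  constant 2.\<close>

lemma walk_shift_odd:
  assumes "1 \<le> n" "n \<le> Q'"
  shows "walk \<alpha> (Q + n) = walk \<alpha> Q + 2 - walk \<alpha> n"
proof -
  have odd: "odd P" using fy by (simp add: farey_def)
  have "walk \<alpha> (Q + Suc k) = walk \<alpha> Q + 2 - walk \<alpha> (Suc k)" if "Suc k \<le> Q'" for k
    using that
  proof (induction k)
    case 0
    show ?case using floor_odd_denominator odd by (simp add: walk_def)
  next
    case (Suc k)
    then have "\<lfloor>real (Q + Suc k) * \<alpha>\<rfloor> = P + \<lfloor>real (Suc k) * \<alpha>\<rfloor>" by (intro floor_shift_odd) auto
    with Suc odd show ?case by (simp add: walk_def del: of_nat_Suc of_nat_add)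
  qed
  from this[of "n - 1"] assms show ?thesis by simp
qed

lemma walk_shift_even_aux:
  assumes "n \<le> Q"
  shows "walk \<alpha> (Q' + n) = walk \<alpha> Q' + walk \<alpha> n"
  using assms
proof (induction n)
  case 0
  then show ?case by (simp add: walk_def)
next
  case (Suc n)
  then have "\<lfloor>real (Q' + n) * \<alpha>\<rfloor> = P' + \<lfloor>real n * \<alpha>\<rfloor>" by (intro floor_shift_even) auto
  moreover have "even P'" using fy by (simp add: farey_def)
  ultimately show ?case using Suc by (simp add: walk_def del: of_nat_Suc of_nat_add)
qed

text \<open>Both shift rules evaluate the walk at time \<open>Q + Q'\<close>, and comparing the
  results leaves only this value.\<close>

lemma walk_even_denominator: "walk \<alpha> Q' = 1"
  using walk_shift_odd[of Q'] walk_shift_even_aux[of Q] fy by (simp add: farey_def add.commute)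

lemma walk_shift_even: "n \<le> Q \<Longrightarrow> walk \<alpha> (Q' + n) = 1 + walk \<alpha> n"
  using walk_shift_even_aux walk_even_denominator by simp

text \<open>The first \<open>Q\<close> steps depend only on \<open>P / Q\<close> and not on the
  choice of \<open>\<alpha>\<close>. An integer separating \<open>i * \<alpha>\<close> from
  \<open>i * P / Q\<close> would have coordinates \<open>a \<ge> 1\<close> and
  \<open>b \<ge> 0\<close>, which forces \<open>i \<ge> Q\<close>.\<close>

lemma walk_near_odd:
  assumes "n \<le> Q"
  shows "walk \<alpha> n = walk (of_int P / real Q) n"
proof -
  have "\<lfloor>real i * \<alpha>\<rfloor> = \<lfloor>real i * (of_int P / real Q)\<rfloor>" if "i < Q" for i
  proof -
    define d d' where "d = of_int P - real Q * \<alpha>" and "d' = real Q' * \<alpha> - of_int P'"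
    have d: "d > 0" "d' > 0" using fy by (auto simp: farey_def d_def d'_def)
    have pos: "Q > 0" "Q' > 0" using fy by (auto simp: farey_def)
    have det: "P * int Q' - P' * int Q = 1" using fy by (auto simp: farey_def)
    define c where "c = \<lfloor>real i * (of_int P / real Q)\<rfloor>"
    have "\<alpha> \<le> of_int P / real Q" using d pos by (simp add: d_def field_simps)
    then have le: "real i * \<alpha> \<le> real i * (of_int P / real Q)" by (intro mult_left_mono) auto
    have cle: "of_int c \<le> real i * (of_int P / real Q)" unfolding c_def by linarith
    have "of_int c \<le> real i * \<alpha>"
    proof (rule ccontr)
      assume "\<not> ?thesis"
      then have gap: "of_int c - real i * \<alpha> > 0" by simp
      obtain a b where ab: "int i = a * int Q + b * int Q'" "c = a * P + b * P'"
        "of_int c - real i * \<alpha> = of_int a * d - of_int b * d'"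
        using farey_lattice[of i c] unfolding d_def d'_def by blast
      have "of_int c * real Q \<le> real i * of_int P" using cle pos by (simp add: field_simps)
      then have "of_int (c * int Q) \<le> (of_int (int i * P) :: real)" by simp
      then have "c * int Q \<le> int i * P" by (simp only: of_int_le_iff)
      moreover have "int i * P - c * int Q = b * (P * int Q' - P' * int Q)"
        by (simp add: ab algebra_simps)
      ultimately have "b \<ge> 0" using det by simp
      then have "of_int b * d' \<ge> 0" using d by simp
      then have "of_int a * d > 0" using gap ab(3) by linarith
      then have "a \<ge> 1" using d by (simp add: zero_less_mult_iff)
      then have "int Q \<le> a * int Q" "0 \<le> b * int Q'" using \<open>b \<ge> 0\<close> pos by auto
      then show False using ab(1) that by linarith
    qed
    then show ?thesis using le unfolding c_def by linarith
  qed
  then show ?thesis using assms unfolding walk_def by (intro sum.cong) auto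
qed

text \<open>A rational strictly between the neighbours has both lattice coordinates at least 1. This
  serves to exclude rational limits of nested intervals.\<close>

lemma farey_denominator_bound:
  assumes "\<alpha> = of_int a / real b" "b > 0"
  shows "Q + Q' \<le> b"
proof -
  obtain x y where xy: "int b = x * int Q + y * int Q'" "a = x * P + y * P'"
    using farey_lattice[of b a] by blast
  have pos: "Q > 0" "Q' > 0" and det: "P * int Q' - P' * int Q = 1"
    and l: "of_int P' < real Q' * \<alpha>" "real Q * \<alpha> < of_int P"
    using fy by (auto simp: farey_def)
  have "(of_int (P' * int b) :: real) < of_int (int Q' * a)" "(of_int (int Q * a) :: real) < of_int (P * int b)"
    using l assms by (simp_all add: field_simps)
  then have "P' * int b < int Q' * a" "int Q * a < P * int b" by (simp_all only: of_int_less_iff)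
  moreover have "int Q' * a - P' * int b = x * (P * int Q' - P' * int Q)" "P * int b - int Q * a = y * (P * int Q' - P' * int Q)"
    by (simp_all add: xy algebra_simps)
  ultimately have "x \<ge> 1" "y \<ge> 1" using det by simp_all
  then have "int Q \<le> x * int Q" "int Q' \<le> y * int Q'" using pos by auto
  then show ?thesis using xy(1) by simp
qed

end

section \<open>Maxima and minima along mediants\<close>

definition spans :: "real \<Rightarrow> nat \<Rightarrow> int \<Rightarrow> int \<Rightarrow> bool" where
  "spans \<alpha> N m M \<longleftrightarrow> walk \<alpha> ` {1..N} \<subseteq> {m..M} \<and> {m, M} \<subseteq> walk \<alpha> ` {1..N}"

lemma spans_bounds: "spans \<alpha> N m M \<Longrightarrow> n \<in> {1..N} \<Longrightarrow> walk \<alpha> n \<in> {m..M}"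
  unfolding spans_def by blast

text \<open>The invariant of the construction. The balance \<open>M + m - 1\<close> makes the
  reflected block that follows a change of sides fit into the range already reached; the conditions
  up to \<open>Q'\<close> ensure that the mediant has minimum exactly \<open>m\<close> and maximum
  exactly \<open>M + 1\<close>.\<close>

definition rising :: "real \<Rightarrow> int \<Rightarrow> nat \<Rightarrow> int \<Rightarrow> nat \<Rightarrow> int \<Rightarrow> int \<Rightarrow> bool" where
  "rising \<alpha> P Q P' Q' m M \<longleftrightarrow> farey \<alpha> P Q P' Q' \<and> spans \<alpha> Q m M \<and> walk \<alpha> Q = M + m - 1 \<and>
     walk \<alpha> ` {1..Q'} \<subseteq> {m..M + 1} \<and> m \<in> walk \<alpha> ` {1..Q'}"

text \<open>After time \<open>Q'\<close> the first \<open>Q\<close> values recur, raised by 1. They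
  can produce the value \<open>M + 1\<close> but never \<open>m\<close>, which must therefore occur
  by time \<open>Q'\<close>.\<close>

lemma spans_add_even:
  assumes fy: "farey \<alpha> P Q P' Q'" and sp: "spans \<alpha> Q m M"
    and sub: "walk \<alpha> ` {1..Q'} \<subseteq> {m..M'}" and m: "m \<in> walk \<alpha> ` {1..Q'}"
    and M: "M + 1 \<le> M'" "M' \<in> walk \<alpha> ` {1..Q'} \<or> M' = M + 1"
  shows "spans \<alpha> (Q + Q') m M'"
proof -
  have "walk \<alpha> n \<in> {m..M'}" if n: "n \<in> {1..Q + Q'}" for n
  proof (cases "n \<le> Q'")
    case True
    then show ?thesis using sub n by (auto simp: image_subset_iff)
  next
    case False
    then obtain j where j: "n = Q' + j" "j \<in> {1..Q}" using n
      by (metis atLeastAtMost_iff le_add_diff_inverse less_imp_le_nat linorder_not_le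
          nat_add_left_cancel_le add.commute One_nat_def Suc_leI zero_less_diff)
    have "walk \<alpha> j \<in> {m..M}" using spans_bounds[OF sp] j by blast
    moreover have "walk \<alpha> n = 1 + walk \<alpha> j" using walk_shift_even[OF fy] j by auto
    ultimately show ?thesis using M by auto
  qed
  moreover have "m \<in> walk \<alpha> ` {1..Q + Q'}" using m by auto
  moreover have "M' \<in> walk \<alpha> ` {1..Q + Q'}"
  proof (cases "M' \<in> walk \<alpha> ` {1..Q'}")
    case False
    then have "M' = M + 1" using M by simp
    moreover obtain j where "j \<in> {1..Q}" "walk \<alpha> j = M" using sp by (auto simp: spans_def)
    ultimately have "walk \<alpha> (Q' + j) = M'" "Q' + j \<in> {1..Q + Q'}"
      using walk_shift_even[OF fy, of j] by auto
    then show ?thesis by blast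
  qed auto
  ultimately show ?thesis by (auto simp: spans_def)
qed

text \<open>Passing to the mediant adds one to the maximum and one to the final value of the walk,
  so the balance persists.\<close>

lemma rising_step:
  assumes r: "rising \<alpha> P Q P' Q' m M" and lt: "real (Q + Q') * \<alpha> < of_int (P + P')"
  shows "rising \<alpha> (P + P') (Q + Q') P' Q' m (M + 1)"
proof -
  have fy: "farey \<alpha> P Q P' Q'" using r by (simp add: rising_def)
  have "spans \<alpha> (Q + Q') m (M + 1)"
    using r by (intro spans_add_even[OF fy]) (auto simp: rising_def)
  moreover have "walk \<alpha> (Q + Q') = M + 1 + m - 1"
    using walk_shift_even[OF fy, of Q] r by (simp add: rising_def add.commute)
  moreover have "farey \<alpha> (P + P') (Q + Q') P' Q'"
    using fy lt by (auto simp: farey_def algebra_simps)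
  ultimately show ?thesis using r by (auto simp: rising_def)
qed

lemma irrational_multiple:
  assumes "\<alpha> \<notin> \<rat>" "0 < i"
  shows "real i * \<alpha> \<notin> \<int>"
proof
  assume "real i * \<alpha> \<in> \<int>"
  then obtain k where "real i * \<alpha> = of_int k" by (auto elim: Ints_cases)
  then have "\<alpha> = of_int k / real i" using assms by (simp add: field_simps)
  then show False using assms by simp
qed

lemma spans_uminus:
  assumes "\<And>i. 0 < i \<Longrightarrow> i < N \<Longrightarrow> real i * \<alpha> \<notin> \<int>" "spans \<alpha> N m M"
  shows "spans (- \<alpha>) N (2 - M) (2 - m)"
proof -
  have w: "walk (- \<alpha>) n = 2 - walk \<alpha> n" if "n \<in> {1..N}" for n
    using that assms by (intro walk_uminus) auto
  have "walk (- \<alpha>) ` {1..N} = (-) 2 ` (walk \<alpha> ` {1..N})"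
    unfolding image_image using w by (intro image_cong) auto
  then show ?thesis using assms(2) by (auto simp: spans_def)
qed

text \<open>The mediant becomes the odd neighbour on the left, and its own mediant with
  \<open>P / Q\<close> the even neighbour on the right; negation restores the standard arrangement.
  In the negated walk the block after time \<open>Q + Q'\<close> is a copy of the original first
  \<open>Q\<close> values, displaced by \<open>2 - (M + m)\<close>. By the balance it stays between
  \<open>2 - M\<close> and \<open>2 - m\<close>.\<close>

lemma rising_turn:
  assumes r: "rising \<alpha> P Q P' Q' m M" and irr: "\<alpha> \<notin> \<rat>"
    and lt: "real (2 * Q + Q') * \<alpha> < of_int (2 * P + P')"
    and gt: "of_int (P + P') < real (Q + Q') * \<alpha>"
  shows "rising (- \<alpha>) (- (P + P')) (Q + Q') (- (2 * P + P')) (2 * Q + Q') (2 - (M + 1)) (2 - m)"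
proof -
  have fy: "farey \<alpha> P Q P' Q'" and sp: "spans \<alpha> Q m M" using r by (auto simp: rising_def)
  have fy': "farey (- \<alpha>) (- (P + P')) (Q + Q') (- (2 * P + P')) (2 * Q + Q')"
    using fy lt gt by (auto simp: farey_def algebra_simps)
  have refl: "walk (- \<alpha>) n = 2 - walk \<alpha> n" if "n \<ge> 1" for n
    using that irr by (intro walk_uminus irrational_multiple) auto
  have "spans \<alpha> (Q + Q') m (M + 1)"
    using r by (intro spans_add_even[OF fy]) (auto simp: rising_def)
  then have sp': "spans (- \<alpha>) (Q + Q') (2 - (M + 1)) (2 - m)"
    using irr by (intro spans_uminus irrational_multiple)
  have K: "walk (- \<alpha>) (Q + Q') = 2 - (M + m)"
    using walk_shift_even[OF fy, of Q] r fy by (simp add: refl rising_def farey_def add.commute)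
  have far: "walk (- \<alpha>) (Q + Q' + j) = 2 - (M + m) + walk \<alpha> j" if "j \<in> {1..Q}" for j
    using walk_shift_odd[OF fy', of j] that K by (simp add: refl)
  have "walk (- \<alpha>) n \<in> {2 - (M + 1)..2 - m + 1}" if n: "n \<in> {1..2 * Q + Q'}" for n
  proof (cases "n \<le> Q + Q'")
    case True
    then show ?thesis using sp' n by (force simp: spans_def image_subset_iff)
  next
    case False
    then have j: "n = Q + Q' + (n - (Q + Q'))" "n - (Q + Q') \<in> {1..Q}" using n by auto
    show ?thesis using far[OF j(2)] j(1) spans_bounds[OF sp j(2)] by simp
  qed
  moreover have "2 - (M + 1) \<in> walk (- \<alpha>) ` {1..2 * Q + Q'}"
    using sp' by (force simp: spans_def)
  ultimately show ?thesis using fy' sp' K by (auto simp: rising_def)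
qed

text \<open>Any \<open>P / Q\<close> can serve as a start, because the lower bound on \<open>walk \<alpha> Q\<close> holds for it or
  for its negative.\<close>

lemma rising_start:
  assumes fy: "farey \<alpha> P Q P' Q'" and "2 * Q \<le> Q'"
    and lt: "real (Q + Q') * \<alpha> < of_int (P + P')"
    and sp: "spans \<alpha> Q m M" and K: "walk \<alpha> Q \<ge> M + m - 1"
  shows "rising \<alpha> (P + P') (Q + Q') P' Q' m (walk \<alpha> Q + 2 - m)"
proof -
  \<comment> \<open>Up to time \<open>Q'\<close> the walk is generated from its first
    \<open>Q\<close> values by the reflection \<open>w\<close> to
    \<open>walk \<alpha> Q + 2 - w\<close>, which maps this range to itself. Assumption
    \<open>K\<close> places the first \<open>Q\<close> values inside it.\<close>
  have bnd: "n \<in> {1..Q'} \<Longrightarrow> walk \<alpha> n \<in> {m..walk \<alpha> Q + 2 - m}" for n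
  proof (induction n rule: less_induct)
    case (less n)
    show ?case
    proof (cases "n \<le> Q")
      case True
      then show ?thesis using less sp K by (force simp: spans_def image_subset_iff)
    next
      case False
      then have j: "n = Q + (n - Q)" "n - Q \<in> {1..Q'}" "n - Q < n" using less fy
        by (auto simp: farey_def)
      have "walk \<alpha> n = walk \<alpha> Q + 2 - walk \<alpha> (n - Q)"
        using walk_shift_odd[OF fy, of "n - Q"] j by auto
      then show ?thesis using less.IH[OF j(3,2)] by auto
    qed
  qed
  obtain j where j: "j \<in> {1..Q}" "walk \<alpha> j = m" using sp by (auto simp: spans_def)
  have m: "m \<in> walk \<alpha> ` {1..Q'}" using j \<open>2 * Q \<le> Q'\<close> by force
  have "walk \<alpha> (Q + j) = walk \<alpha> Q + 2 - m" using walk_shift_odd[OF fy, of j] j \<open>2 * Q \<le> Q'\<close> by auto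
  moreover have "Q + j \<in> {1..Q'}" using j \<open>2 * Q \<le> Q'\<close> by auto
  ultimately have M: "walk \<alpha> Q + 2 - m \<in> walk \<alpha> ` {1..Q'}" by (metis imageI)
  have "spans \<alpha> (Q + Q') m (walk \<alpha> Q + 2 - m)"
    using bnd m M K by (intro spans_add_even[OF fy sp]) auto
  moreover have "walk \<alpha> (Q + Q') = 1 + walk \<alpha> Q"
    using walk_shift_even[OF fy, of Q] by (simp add: add.commute)
  moreover have "farey \<alpha> (P + P') (Q + Q') P' Q'"
    using fy lt by (auto simp: farey_def algebra_simps)
  moreover have "walk \<alpha> ` {1..Q'} \<subseteq> {m..walk \<alpha> Q + 2 - m + 1}" using bnd by force
  ultimately show ?thesis using m by (simp add: rising_def)
qed

section \<open>Nested Farey intervals\<close>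

text \<open>A frame \<open>(P, Q, P', Q')\<close> stands for the interval between \<open>P / Q\<close> and \<open>P' / Q'\<close>; the accompanying
  truth value tells whether the fraction \<open>P' / Q'\<close> with even numerator is the left endpoint.\<close>

type_synonym frame = "int \<times> nat \<times> int \<times> nat"

fun frame :: "bool \<Rightarrow> frame \<Rightarrow> bool" where
  "frame s (P, Q, P', Q') \<longleftrightarrow> odd P \<and> even P' \<and> 0 < Q \<and> 0 < Q' \<and>
     P * int Q' - P' * int Q = (if s then 1 else -1)"

fun left_end :: "bool \<Rightarrow> frame \<Rightarrow> real" where
  "left_end s (P, Q, P', Q') = (if s then of_int P' / real Q' else of_int P / real Q)"

abbreviation right_end :: "bool \<Rightarrow> frame \<Rightarrow> real" where
  "right_end s \<equiv> left_end (\<not> s)"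

text \<open>If the even fraction is on the right, everything is reflected at \<open>0\<close>, which replaces
  \<^term>\<open>walk \<alpha> n\<close> by \<^term>\<open>2 - walk \<alpha> n\<close>.\<close>

fun stage :: "bool \<Rightarrow> real \<Rightarrow> frame \<Rightarrow> int \<Rightarrow> int \<Rightarrow> bool" where
  "stage s \<alpha> (P, Q, P', Q') m M \<longleftrightarrow>
     (if s then rising \<alpha> P Q P' Q' m M else rising (- \<alpha>) (- P) Q (- P') Q' (2 - M) (2 - m))"

text \<open>The parameters \<open>s\<close> and \<open>t\<close> are the sides of the even fraction
  before and after. The mediant always replaces the odd fraction; at a change of sides the even one
  is replaced by the mediant of the old and the new odd fraction.\<close>

fun advance :: "bool \<Rightarrow> bool \<Rightarrow> frame \<Rightarrow> frame" where
  "advance s t (P, Q, P', Q') =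
     (P + P', Q + Q', if s = t then P' else 2 * P + P', if s = t then Q' else 2 * Q + Q')"

lemma frame_advance: "frame s F \<Longrightarrow> frame t (advance s t F)"
  by (cases F) (auto simp: algebra_simps split: if_splits)

lemma fraction_less_iff:
  assumes "0 < q" "0 < q'"
  shows "of_int p / real q < of_int p' / real q' \<longleftrightarrow> p * int q' < p' * int q"
proof -
  have "of_int p / real q < of_int p' / real q' \<longleftrightarrow> (of_int (p * int q') :: real) < of_int (p' * int q)"
    using assms by (simp add: field_simps)
  then show ?thesis by (simp only: of_int_less_iff)
qed

lemma fraction_le_iff:
  assumes "0 < q" "0 < q'"
  shows "of_int p / real q \<le> of_int p' / real q' \<longleftrightarrow> p * int q' \<le> p' * int q"
  using fraction_less_iff[OF assms(2,1), of p' p] by (simp flip: not_less)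

lemma left_end_less_right_end: "frame s F \<Longrightarrow> left_end s F < right_end s F"
  by (cases F) (auto simp: fraction_less_iff)

text \<open>At a change of sides both old endpoints are discarded, whereas otherwise the even one is
  kept.\<close>

lemma advance_nested_strict:
  "frame s F \<Longrightarrow> s \<noteq> t \<Longrightarrow>
    left_end s F < left_end t (advance s t F) \<and> right_end t (advance s t F) < right_end s F"
  by (cases F; cases s) (auto simp: fraction_less_iff simp del: of_nat_add of_int_add, auto simp: algebra_simps)

lemma advance_nested:
  "frame s F \<Longrightarrow>
    left_end s F \<le> left_end t (advance s t F) \<and> right_end t (advance s t F) \<le> right_end s F"
  by (cases F; cases s; cases t)
    (auto simp: fraction_le_iff simp del: of_nat_add of_int_add, auto simp: algebra_simps)

text \<open>Which extremum grows depends on the present side \<open>s\<close> alone; the next side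
  \<open>t\<close> decides between \<open>rising_step\<close> and
  \<open>rising_turn\<close>.\<close>

lemma stage_advance:
  assumes "stage s \<alpha> F m M" and irr: "\<alpha> \<notin> \<rat>"
    and "left_end t (advance s t F) < \<alpha>" "\<alpha> < right_end t (advance s t F)"
  shows "stage t \<alpha> (advance s t F) (if s then m else m - 1) (if s then M + 1 else M)"
proof -
  obtain P Q P' Q' where F: "F = (P, Q, P', Q')" by (cases F)
  show ?thesis
  proof (cases s)
    case True
    then have r: "rising \<alpha> P Q P' Q' m M" and pos: "0 < Q" "0 < Q'"
      using assms(1) F by (auto simp: rising_def farey_def)
    show ?thesis
      using rising_step[OF r] rising_turn[OF r irr] assms(3,4) pos True F
      by (cases t) (auto simp: field_simps)
  next
    case False
    then have r: "rising (- \<alpha>) (- P) Q (- P') Q' (2 - M) (2 - m)" and pos: "0 < Q" "0 < Q'"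
      using assms(1) F by (auto simp: rising_def farey_def)
    have irr': "- \<alpha> \<notin> \<rat>" using irr by simp
    show ?thesis
      using rising_step[OF r] rising_turn[OF r irr'] assms(3,4) pos False F
      by (cases t) (auto simp: field_simps)
  qed
qed

primrec frames :: "(nat \<Rightarrow> bool) \<Rightarrow> frame \<Rightarrow> nat \<Rightarrow> frame" where
  "frames s F 0 = F"
| "frames s F (Suc k) = advance (s k) (s (Suc k)) (frames s F k)"

text \<open>The supremum of the left endpoints lies in all closed intervals. Each later change of
  sides moves both endpoints strictly, which puts it in the open ones.\<close>

lemma frames_limit:
  assumes F: "frame (s 0) F" and changes: "\<And>k. \<exists>j\<ge>k. s (Suc j) \<noteq> s j"
  obtains \<alpha> where "\<And>k. left_end (s k) (frames s F k) < \<alpha>" "\<And>k. \<alpha> < right_end (s k) (frames s F k)"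
proof -
  define a b where "a k = left_end (s k) (frames s F k)" and "b k = right_end (s k) (frames s F k)" for k
  have fr: "frame (s k) (frames s F k)" for k
    by (induction k) (auto simp: F frame_advance simp del: frame.simps)
  have "a k \<le> a (Suc k)" "b (Suc k) \<le> b k" for k
    using advance_nested[OF fr] by (simp_all add: a_def b_def)
  then have mono: "incseq a" "decseq b" by (auto simp: incseq_Suc_iff decseq_Suc_iff)
  have ab: "a k < b k" for k unfolding a_def b_def by (rule left_end_less_right_end[OF fr])
  have le: "a i \<le> b j" for i j
    using incseqD[OF mono(1), of i "max i j"] decseqD[OF mono(2), of j "max i j"] ab[of "max i j"] by simp
  define \<alpha> where "\<alpha> = (SUP k. a k)"
  have "bdd_above (range a)" using le by (auto intro: bdd_aboveI[of _ "b 0"])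
  then have \<alpha>: "a k \<le> \<alpha>" "\<alpha> \<le> b k" for k
    unfolding \<alpha>_def using le by (auto intro: cSUP_upper cSUP_least)
  have "a k < \<alpha> \<and> \<alpha> < b k" for k
  proof -
    obtain j where j: "j \<ge> k" "s (Suc j) \<noteq> s j" using changes by blast
    have "a j < a (Suc j)" "b (Suc j) < b j"
      using advance_nested_strict[OF fr[of j], of "s (Suc j)"] j by (auto simp: a_def b_def)
    then show ?thesis
      using incseqD[OF mono(1) j(1)] decseqD[OF mono(2) j(1)] \<alpha>[of "Suc j"] by linarith
  qed
  then show ?thesis using that unfolding a_def b_def by blast
qed

text \<open>The odd denominator of frame \<open>k\<close> exceeds \<open>k\<close>, so a rational
  with denominator \<open>q\<close> would violate \<open>farey_denominator_bound\<close> in frame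
  \<open>q\<close>.\<close>

lemma irrational_if_in_frames:
  assumes F: "frame (s 0) F"
    and \<alpha>: "\<And>k. left_end (s k) (frames s F k) < \<alpha>" "\<And>k. \<alpha> < right_end (s k) (frames s F k)"
  shows "\<alpha> \<notin> \<rat>"
proof
  assume "\<alpha> \<in> \<rat>"
  then obtain r q where rq: "\<alpha> = of_int r / real q" "q > 0"
    by (metis Rats_cases' of_int_of_nat_eq zero_less_imp_eq_int of_nat_0_less_iff)
  have fr: "frame (s k) (frames s F k)" for k
    by (induction k) (auto simp: F frame_advance simp del: frame.simps)
  have grow: "k < fst (snd (frames s F k))" for k
  proof (induction k)
    case 0
    show ?case using F by (cases F) auto
  next
    case (Suc k)
    then show ?case using fr[of k] by (cases "frames s F k") auto
  qed
  obtain P Q P' Q' where E: "frames s F q = (P, Q, P', Q')" by (cases "frames s F q")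
  have "Q + Q' \<le> q"
  proof (cases "s q")
    case True
    then have "farey \<alpha> P Q P' Q'"
      using fr[of q] \<alpha>[of q] by (auto simp: E farey_def field_simps)
    then show ?thesis using rq by (rule farey_denominator_bound)
  next
    case False
    then have "farey (- \<alpha>) (- P) Q (- P') Q'"
      using fr[of q] \<alpha>[of q] by (auto simp: E farey_def field_simps)
    moreover have "- \<alpha> = of_int (- r) / real q" using rq by simp
    ultimately show ?thesis using rq(2) by (rule farey_denominator_bound)
  qed
  then show False using grow[of q] E by simp
qed

section \<open>Starting frames near a given rational\<close>

lemma exists_farey_neighbour:
  fixes P :: int and Q N :: nat
  assumes "odd P" "0 < Q" "coprime P (int Q)"
  obtains P' Q' where "P * int Q' - P' * int Q = 1" "even P'" "N \<le> Q'"
proof -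
  obtain u v where uv: "u * P + v * int Q = 1"
    using bezout_int[of P "int Q"] assms(3) by (auto simp: coprime_iff_gcd_eq_1)
  \<comment> \<open>Bezout solutions may be shifted by any \<open>t\<close>. Parity equal to that of
    \<open>v\<close> makes \<open>t * P - v\<close> even, as \<open>P\<close> is odd, and the size
    of \<open>t\<close> gives \<open>Q' \<ge> N\<close>.\<close>
  define t where "t = v + 2 * (int N + \<bar>u\<bar> + \<bar>v\<bar>)"
  define Q' P' where "Q' = nat (u + t * int Q)" and "P' = t * P - v"
  have "(int N + \<bar>u\<bar>) * 1 \<le> (int N + \<bar>u\<bar>) * int Q"
    using assms by (intro mult_left_mono) auto
  moreover have "int N + \<bar>u\<bar> \<le> t" unfolding t_def by auto
  then have "(int N + \<bar>u\<bar>) * int Q \<le> t * int Q" by (intro mult_right_mono) auto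
  ultimately have "int N + \<bar>u\<bar> \<le> t * int Q" by simp
  then have ge: "int N \<le> u + t * int Q" by linarith
  then have "int Q' = u + t * int Q" by (simp add: Q'_def)
  then have "P * int Q' - P' * int Q = u * P + v * int Q"
    by (simp add: P'_def algebra_simps)
  moreover have "even P'" using assms unfolding P'_def t_def by auto
  ultimately show ?thesis using that[of Q' P'] uv ge by (auto simp: Q'_def le_nat_iff)
qed

text \<open>The even neighbour lies at distance \<open>1 / (Q * Q')\<close> below
  \<open>\<beta>\<close>, and the frame consists of it and the mediant. By
  \<open>walk_near_odd\<close> the resulting maximum is the same for all \<open>\<alpha>\<close> in
  the frame.\<close>

lemma exists_rising_frame:
  fixes P :: int and Q :: nat
  defines "\<beta> \<equiv> of_int P / real Q"
  assumes PQ: "odd P" "0 < Q" "coprime P (int Q)" and "0 < \<epsilon>"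
    and sp: "spans \<beta> Q m M" and K: "M + m - 1 \<le> walk \<beta> Q"
  obtains F M' where "frame True F" "\<beta> - \<epsilon> < left_end True F" "right_end True F < \<beta> + \<epsilon>"
    "\<And>\<alpha>. left_end True F < \<alpha> \<Longrightarrow> \<alpha> < right_end True F \<Longrightarrow> stage True \<alpha> F m M'"
proof -
  obtain N where N: "1 / \<epsilon> < real N" using reals_Archimedean2 by blast
  obtain P' Q' where det: "P * int Q' - P' * int Q = 1" and ev: "even P'" and Q': "max N (2 * Q) \<le> Q'"
    using exists_farey_neighbour[OF PQ] by blast
  have pos: "0 < Q'" using Q' PQ by simp
  define F where "F = (P + P', Q + Q', P', Q')"
  have fr: "frame True F" using PQ pos det ev by (auto simp: F_def algebra_simps)
  have less: "right_end True F < \<beta>"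
  proof -
    have "(P + P') * int Q < P * int (Q + Q')" using det by (simp add: algebra_simps)
    then show ?thesis unfolding F_def \<beta>_def using PQ pos
      by (simp add: fraction_less_iff del: of_int_add of_nat_add)
  qed
  have "1 < \<epsilon> * real Q'"
  proof -
    have "1 < \<epsilon> * real N" using N \<open>0 < \<epsilon>\<close> by (simp add: field_simps)
    also have "\<dots> \<le> \<epsilon> * real Q'" using Q' \<open>0 < \<epsilon>\<close> by (intro mult_left_mono) auto
    finally show ?thesis .
  qed
  also have "\<epsilon> * real Q' = \<epsilon> * real Q' * 1" by simp
  also have "\<dots> \<le> \<epsilon> * real Q' * real Q" using PQ \<open>0 < \<epsilon>\<close> by (intro mult_left_mono) auto
  finally have "real_of_int (P * int Q' - P' * int Q) < \<epsilon> * real Q' * real Q" using det by simp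
  then have close: "\<beta> - \<epsilon> < left_end True F"
    using PQ pos by (simp add: F_def \<beta>_def field_simps)
  show ?thesis
  proof (rule that[OF fr close])
    show "right_end True F < \<beta> + \<epsilon>" using less \<open>0 < \<epsilon>\<close> by simp
    fix \<alpha> assume \<alpha>: "left_end True F < \<alpha>" "\<alpha> < right_end True F"
    have "\<alpha> < \<beta>" using \<alpha> less by simp
    then have fy: "farey \<alpha> P Q P' Q'"
      using \<alpha> PQ pos det ev by (simp add: farey_def F_def \<beta>_def field_simps)
    have walk_eq: "walk \<alpha> n = walk \<beta> n" if "n \<le> Q" for n
      unfolding \<beta>_def by (rule walk_near_odd[OF fy that])
    then have "walk \<alpha> ` {1..Q} = walk \<beta> ` {1..Q}" by (intro image_cong) auto
    then have "spans \<alpha> Q m M" using sp by (simp add: spans_def)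
    moreover have "real (Q + Q') * \<alpha> < of_int (P + P')" using \<alpha> pos by (simp add: F_def field_simps)
    ultimately show "stage True \<alpha> F m (walk \<beta> Q + 2 - m)"
      using rising_start[OF fy] Q' K walk_eq[of Q] by (simp add: F_def)
  qed
qed

text \<open>If the lower bound on the walk at time \<open>Q\<close> fails for
  \<open>\<beta>\<close>, then it holds for \<open>- \<beta>\<close>, and the frame found there is
  reflected back.\<close>

lemma exists_stage:
  fixes P :: int and Q :: nat
  defines "\<beta> \<equiv> of_int P / real Q"
  assumes PQ: "odd P" "0 < Q" "coprime P (int Q)" and "0 < \<epsilon>"
  obtains s F m M where "frame s F" "\<beta> - \<epsilon> < left_end s F" "right_end s F < \<beta> + \<epsilon>"
    "\<And>\<alpha>. left_end s F < \<alpha> \<Longrightarrow> \<alpha> < right_end s F \<Longrightarrow> stage s \<alpha> F m M"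
proof -
  have ne: "finite (walk \<beta> ` {1..Q})" "walk \<beta> ` {1..Q} \<noteq> {}" using PQ by auto
  define m M where "m = Min (walk \<beta> ` {1..Q})" and "M = Max (walk \<beta> ` {1..Q})"
  have sp: "spans \<beta> Q m M"
    unfolding spans_def m_def M_def using Min_in[OF ne] Max_in[OF ne] ne by auto
  show ?thesis
  proof (cases "M + m - 1 \<le> walk \<beta> Q")
    case True
    obtain F M' where "frame True F" "\<beta> - \<epsilon> < left_end True F" "right_end True F < \<beta> + \<epsilon>"
      "\<And>\<alpha>. left_end True F < \<alpha> \<Longrightarrow> \<alpha> < right_end True F \<Longrightarrow> stage True \<alpha> F m M'"
      using exists_rising_frame[OF PQ \<open>0 < \<epsilon>\<close> sp[unfolded \<beta>_def] True[unfolded \<beta>_def]]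
      unfolding \<beta>_def by blast
    then show ?thesis by (rule that)
  next
    case False
    have nint: "real i * \<beta> \<notin> \<int>" if i: "0 < i" "i < Q" for i
    proof
      assume "real i * \<beta> \<in> \<int>"
      then obtain c where "real i * \<beta> = of_int c" by (auto elim: Ints_cases)
      then have "(of_int (int i * P) :: real) = of_int (c * int Q)"
        using PQ by (simp add: \<beta>_def field_simps)
      then have "int i * P = c * int Q" by (simp only: of_int_eq_iff)
      then have "int Q dvd int i * P" by simp
      then have "int Q dvd int i"
        using PQ(3) by (simp add: coprime_dvd_mult_left_iff coprime_commute)
      then show False using i by (auto dest: dvd_imp_le)
    qed
    have \<beta>: "- \<beta> = of_int (- P) / real Q" by (simp add: \<beta>_def)
    have PQ': "odd (- P)" "0 < Q" "coprime (- P) (int Q)" using PQ by auto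
    have sp': "spans (- \<beta>) Q (2 - M) (2 - m)" using nint sp by (rule spans_uminus)
    have K: "2 - m + (2 - M) - 1 \<le> walk (- \<beta>) Q"
      using walk_uminus[of Q \<beta>] nint PQ False by simp
    obtain F M' where F: "frame True F" "- \<beta> - \<epsilon> < left_end True F" "right_end True F < - \<beta> + \<epsilon>"
      "\<And>\<alpha>. left_end True F < \<alpha> \<Longrightarrow> \<alpha> < right_end True F \<Longrightarrow> stage True \<alpha> F (2 - M) M'"
      using exists_rising_frame[OF PQ' \<open>0 < \<epsilon>\<close> sp'[unfolded \<beta>] K[unfolded \<beta>]]
      unfolding \<beta> by blast
    obtain P1 Q1 P' Q' where Fe: "F = (P1, Q1, P', Q')" by (cases F)
    show ?thesis
    proof (rule that[of False "(- P1, Q1, - P', Q')" "2 - M'" M])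
      fix \<alpha> assume "left_end False (- P1, Q1, - P', Q') < \<alpha>" "\<alpha> < right_end False (- P1, Q1, - P', Q')"
      then show "stage False \<alpha> (- P1, Q1, - P', Q') (2 - M') M"
        using F(4)[of "- \<alpha>"] by (auto simp: Fe)
    qed (use F(1-3) in \<open>auto simp: Fe\<close>)
  qed
qed

section \<open>Lattice paths with prescribed slopes\<close>

text \<open>A discrete intermediate value argument: a sequence that is repeatedly above
  \<open>a\<close> and below \<open>b\<close>, and eventually never jumps down across the gap
  between them, must visit that gap again and again. It suffices to control downward jumps.\<close>

lemma seq_accumulation_points_interval:
  fixes u :: "nat \<Rightarrow> 'a :: {linorder_topology, dense_linorder}"
  assumes lower: "\<And>a. a < r1 \<Longrightarrow> eventually (\<lambda>n. a < u n) sequentially"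
    and upper: "\<And>b. r2 < b \<Longrightarrow> eventually (\<lambda>n. u n < b) sequentially"
    and high: "\<And>a k. a < r2 \<Longrightarrow> \<exists>n\<ge>k. a < u n"
    and low: "\<And>b k. r1 < b \<Longrightarrow> \<exists>n\<ge>k. u n < b"
    and slow: "\<And>a b. a < b \<Longrightarrow> eventually (\<lambda>n. \<not> (b \<le> u n \<and> u (Suc n) \<le> a)) sequentially"
  shows "seq_accumulation_points u = {r1..r2}"
proof (intro equalityI subsetI)
  fix l assume "l \<in> seq_accumulation_points u"
  then have l: "\<exists>n\<ge>k. u n \<in> U" if "open U" "l \<in> U" for U k
    using that by (auto simp: seq_accumulation_points_def infinite_nat_iff_unbounded_le)
  show "l \<in> {r1..r2}"
  proof (rule ccontr)
    assume "l \<notin> {r1..r2}"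
    then consider "l < r1" | "r2 < l" by fastforce
    then show False
    proof cases
      case 1
      then obtain a where a: "l < a" "a < r1" using dense by blast
      then obtain k where "\<And>n. n \<ge> k \<Longrightarrow> a < u n" using lower by (auto simp: eventually_sequentially)
      moreover obtain n where "n \<ge> k" "u n \<in> {..<a}" using l[of "{..<a}" k] a by auto
      ultimately show False by fastforce
    next
      case 2
      then obtain b where b: "r2 < b" "b < l" using dense by blast
      then obtain k where "\<And>n. n \<ge> k \<Longrightarrow> u n < b" using upper by (auto simp: eventually_sequentially)
      moreover obtain n where "n \<ge> k" "u n \<in> {b<..}" using l[of "{b<..}" k] b by auto
      ultimately show False by fastforce
    qed
  qed
next
  fix c assume c: "c \<in> {r1..r2}"
  have "\<exists>n\<ge>k. u n \<in> U" if U: "open U" "c \<in> U" for U k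
  \<comment> \<open>A least or greatest element of the type, such as 0 or infinity in
    \<open>ennreal\<close>, has neighbourhoods on one side only and is treated separately.\<close>
  proof (cases "\<exists>a. a < c"; cases "\<exists>b. c < b")
    assume "\<exists>a. a < c" "\<exists>b. c < b"
    then obtain a b where ab: "a < c" "{a<..c} \<subseteq> U" "c < b" "{c..<b} \<subseteq> U"
      using open_left[OF U] open_right[OF U] by metis
    then have "a < b" by order
    then obtain k' where k': "\<And>n. n \<ge> k' \<Longrightarrow> \<not> (b \<le> u n \<and> u (Suc n) \<le> a)"
      using slow[of a b] unfolding eventually_sequentially by blast
    have "a < r2" "r1 < b" using ab c by auto
    then obtain i j where i: "i \<ge> max k k'" "a < u i" and j: "j \<ge> i" "u j < b"
      using high low by metis
    have "\<exists>n\<ge>i. a < u n \<and> u n < b"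
    proof (rule ccontr)
      assume *: "\<not> ?thesis"
      have "b \<le> u j" using j(1)
      proof (induction rule: dec_induct)
        case base
        then show ?case using * i by fastforce
      next
        case (step n)
        then have "\<not> u (Suc n) \<le> a" using k'[of n] i by auto
        then show ?case using * step by (meson le_SucI linorder_not_le)
      qed
      then show False using j by simp
    qed
    then obtain n where "n \<ge> i" "a < u n" "u n < b" by blast
    moreover from this have "u n \<in> {a<..c} \<union> {c..<b}" by auto
    then have "u n \<in> U" using ab by blast
    ultimately show ?thesis using i by (intro exI[of _ n]) auto
  next
    assume a: "\<exists>a. a < c" and b: "\<nexists>b. c < b"
    then obtain a where a: "a < c" "{a<..c} \<subseteq> U" using open_left[OF U] by metis
    then have "a < r2" using c by auto
    then obtain n where "n \<ge> k" "a < u n" using high by blast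
    then show ?thesis using a b U by (metis (mono_tags) atLeastLessThan_iff greaterThanAtMost_iff not_less subsetD)
  next
    assume a: "\<nexists>a. a < c" and b: "\<exists>b. c < b"
    then obtain b where b: "c < b" "{c..<b} \<subseteq> U" using open_right[OF U] by metis
    then have "r1 < b" using c by auto
    then obtain n where "n \<ge> k" "u n < b" using low by blast
    then show ?thesis using a b U by (metis (mono_tags) atLeastLessThan_iff greaterThanAtMost_iff not_less subsetD)
  next
    assume "\<nexists>a. a < c" "\<nexists>b. c < b"
    then have "u k = c" by (meson linorder_neqE)
    then show ?thesis using U by auto
  qed
  then show "c \<in> seq_accumulation_points u"
    by (auto simp: seq_accumulation_points_def infinite_nat_iff_unbounded_le)
qed

text \<open>Between consecutive times \<open>N k\<close> only the two adjacent values of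
  \<open>v\<close> occur, so a set visited infinitely often by one sequence is so visited by the
  other.\<close>

lemma seq_accumulation_points_time_change:
  fixes u v :: "nat \<Rightarrow> 'a :: topological_space"
  assumes mono: "strict_mono N" and eq: "\<And>k. u (N k) = v k"
    and between: "\<And>k n. N k \<le> n \<Longrightarrow> n \<le> N (Suc k) \<Longrightarrow> u n = v k \<or> u n = v (Suc k)"
  shows "seq_accumulation_points u = seq_accumulation_points v"
proof -
  have "infinite {n. u n \<in> U} \<longleftrightarrow> infinite {k. v k \<in> U}" for U
  proof
    assume inf: "infinite {n. u n \<in> U}"
    show "infinite {k. v k \<in> U}" unfolding infinite_nat_iff_unbounded_le
    proof
      fix k
      obtain n where n: "n \<ge> N k" "u n \<in> U"
        using inf unfolding infinite_nat_iff_unbounded_le by blast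
      define j where "j = Max {j. N j \<le> n}"
      have fin: "finite {j. N j \<le> n}"
        by (rule finite_subset[of _ "{..n}"]) (use strict_mono_imp_increasing[OF mono] order_trans in auto)
      have "N j \<le> n" using Max_in[OF fin] n unfolding j_def by blast
      moreover have "k \<le> j" using Max_ge[OF fin] n unfolding j_def by blast
      moreover have "n \<le> N (Suc j)"
      proof (rule ccontr)
        assume "\<not> ?thesis"
        then have "Suc j \<le> j" using Max_ge[OF fin, of "Suc j"] unfolding j_def by simp
        then show False by simp
      qed
      ultimately show "\<exists>i\<ge>k. i \<in> {k. v k \<in> U}" using between[of j n] n by (metis le_SucI mem_Collect_eq)
    qed
  next
    assume "infinite {k. v k \<in> U}"
    then have "infinite (N ` {k. v k \<in> U})"
      using strict_mono_imp_inj_on[OF mono] by (metis finite_imageD inj_on_subset subset_UNIV)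
    moreover have "N ` {k. v k \<in> U} \<subseteq> {n. u n \<in> U}" using eq by auto
    ultimately show "infinite {n. u n \<in> U}" using finite_subset by blast
  qed
  then show ?thesis by (simp add: seq_accumulation_points_def)
qed

text \<open>Positive finite thresholds are wanted even for the limits 0 and infinity, since only
  these are crossed after finitely many moves.\<close>

lemma ennreal_pos_approx:
  obtains h :: "nat \<Rightarrow> real" where "\<And>n. 0 < h n" and "(\<lambda>n. ennreal (h n)) \<longlonglongrightarrow> r"
proof (cases r)
  case (real a)
  have "(\<lambda>n. a + inverse (real (Suc n))) \<longlonglongrightarrow> a + 0"
    by (intro tendsto_intros LIMSEQ_inverse_real_of_nat)
  then have "(\<lambda>n. ennreal (a + inverse (real (Suc n)))) \<longlonglongrightarrow> r"
    unfolding real by (intro tendsto_ennrealI) simp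
  then show ?thesis using real by (intro that[of "\<lambda>n. a + inverse (real (Suc n))"]) (auto simp: add_nonneg_pos)
next
  case top
  have "(\<lambda>n. ennreal (real (Suc n))) \<longlonglongrightarrow> r"
    unfolding top ennreal_of_nat_eq_real_of_nat[symmetric]
    by (rule LIMSEQ_Suc[OF of_nat_tendsto_top_ennreal])
  then show ?thesis by (intro that[of "\<lambda>n. real (Suc n)"]) auto
qed

lemma ennreal_dense_real:
  fixes a b :: ennreal
  assumes "a < b"
  obtains c :: real where "0 < c" "a < ennreal c" "ennreal c < b"
proof -
  obtain d where d: "a < d" "d < b" using assms dense by blast
  then obtain c where "0 \<le> c" "d = ennreal c" by (cases d) auto
  then show ?thesis using that[of c] d by (cases "c = 0") auto
qed

lemma
  fixes x y :: int and c :: real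
  assumes "0 < x" "0 < y" "0 < c"
  shows ennreal_le_ratio: "ennreal c \<le> ennreal x / ennreal \<bar>y\<bar> \<longleftrightarrow> c * y \<le> x"
    and ratio_le_ennreal: "ennreal x / ennreal \<bar>y\<bar> \<le> ennreal c \<longleftrightarrow> x \<le> c * y"
proof -
  have "ennreal x / ennreal \<bar>y\<bar> = ennreal (x / y)" using assms by (simp add: divide_ennreal)
  then show "ennreal c \<le> ennreal x / ennreal \<bar>y\<bar> \<longleftrightarrow> c * y \<le> x"
    "ennreal x / ennreal \<bar>y\<bar> \<le> ennreal c \<longleftrightarrow> x \<le> c * y"
    using assms by (simp_all add: ennreal_le_iff field_simps)
qed

section \<open>Construction of the lattice path\<close>

fun path_step :: "(nat \<Rightarrow> real) \<Rightarrow> (nat \<Rightarrow> real) \<Rightarrow> bool \<times> int \<times> int \<Rightarrow> bool \<times> int \<times> int" where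
  "path_step h l (s, x, y) =
    (let x' = (if s then x + 1 else x); y' = (if s then y else y + 1)
     in (if s then x' < h (nat y') * y' else x' \<le> l (nat x') * y', x', y'))"

lemma exists_change:
  fixes i j :: nat
  assumes "i \<le> j" "P i" "\<not> P j"
  obtains k where "i \<le> k" "P k" "\<not> P (Suc k)"
proof -
  have "\<exists>k\<ge>i. P k \<and> \<not> P (Suc k)"
  proof (rule ccontr)
    assume *: "\<not> ?thesis"
    from \<open>i \<le> j\<close> have "P j" by (induction rule: dec_induct) (use * \<open>P i\<close> in auto)
    then show False using assms by simp
  qed
  then show ?thesis using that by blast
qed

text \<open>A lattice path that moves right until the ratio \<open>x / y\<close> reaches an approximation of \<open>r2\<close>,
  then up until the ratio has dropped to an approximation of \<open>r1\<close>, and so on. The approximations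
  are read off from the coordinate that is at rest, so that every run terminates.\<close>

lemma exists_lattice_path:
  fixes r1 r2 :: ennreal and x0 y0 :: int
  assumes "r1 \<le> r2"
  obtains s :: "nat \<Rightarrow> bool" and x y :: "nat \<Rightarrow> int"
  where "s 0 = s0" "x 0 = x0" "y 0 = y0"
    and "\<And>k. x (Suc k) = (if s k then x k + 1 else x k)"
    and "\<And>k. y (Suc k) = (if s k then y k else y k + 1)"
    and "\<And>k. \<exists>j\<ge>k. s (Suc j) \<noteq> s j"
    and "seq_accumulation_points (\<lambda>k. ennreal (x k) / ennreal \<bar>y k\<bar>) = {r1..r2}"
proof -
  obtain l where l: "\<And>n. 0 < l n" "(\<lambda>n. ennreal (l n)) \<longlonglongrightarrow> r1" using ennreal_pos_approx by metis
  obtain h where h: "\<And>n. 0 < h n" "(\<lambda>n. ennreal (h n)) \<longlonglongrightarrow> r2" using ennreal_pos_approx by metis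
  define st where "st k = (path_step h l ^^ k) (s0, x0, y0)" for k
  define s x y where "s k = fst (st k)" and "x k = fst (snd (st k))" and "y k = snd (snd (st k))" for k
  have st: "st k = (s k, x k, y k)" for k by (simp add: s_def x_def y_def)
  have init: "s 0 = s0" "x 0 = x0" "y 0 = y0" by (simp_all add: s_def x_def y_def st_def)
  have "st (Suc k) = path_step h l (s k, x k, y k)" for k
    using st[of k] by (simp add: st_def)
  then have xS: "x (Suc k) = (if s k then x k + 1 else x k)"
    and yS: "y (Suc k) = (if s k then y k else y k + 1)"
    and sS: "s (Suc k) = (if s k then x (Suc k) < h (nat (y (Suc k))) * y (Suc k)
      else x (Suc k) \<le> l (nat (x (Suc k))) * y (Suc k))" for k
    using st[of "Suc k"] by (auto simp: Let_def)
  \<comment> \<open>In an endless run the threshold would stay fixed, being indexed by the resting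
    coordinate, while the other coordinate grows without bound.\<close>
  have changes: "\<exists>j\<ge>k. s (Suc j) \<noteq> s j" for k
  proof (rule ccontr)
    assume "\<not> ?thesis"
    then have const: "s (k + i) = s k" for i by (induction i) auto
    show False
    proof (cases "s k")
      case True
      have xy: "x (k + i) = x k + int i \<and> y (k + i) = y k" for i
        by (induction i) (auto simp: xS yS const True)
      obtain i where i: "h (nat (y k)) * y k - x k < real i" using reals_Archimedean2 by blast
      have "x (k + Suc i) < h (nat (y k)) * y k"
        using sS[of "k + i"] const[of i] const[of "Suc i"] True xy[of "Suc i"] by simp
      then show False using i xy[of "Suc i"] by simp
    next
      case False
      have xy: "y (k + i) = y k + int i \<and> x (k + i) = x k" for i
        by (induction i) (auto simp: xS yS const False)
      obtain i where i: "x k / l (nat (x k)) - y k < real i" using reals_Archimedean2 by blast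
      have "\<not> x k \<le> l (nat (x k)) * y (k + Suc i)"
        using sS[of "k + i"] const[of i] const[of "Suc i"] False xy[of "Suc i"] by simp
      moreover have "x k / l (nat (x k)) \<le> y (k + Suc i)" using i xy[of "Suc i"] by simp
      ultimately show False using l(1)[of "nat (x k)"] by (simp add: field_simps)
    qed
  qed
  have ex_right: "\<exists>j\<ge>k. s j" and ex_up: "\<exists>j\<ge>k. \<not> s j" for k
    using changes[of k] le_SucI by metis+
  have mono: "mono x" "mono y" unfolding mono_iff_le_Suc by (auto simp: xS yS)
  have unbounded: "\<exists>k. b < x k" "\<exists>k. b < y k" for b
  proof -
    have "\<exists>k. x 0 + int n \<le> x k \<and> y 0 + int n \<le> y k" for n
    proof (induction n)
      case (Suc n)
      then obtain k where k: "x 0 + int n \<le> x k" "y 0 + int n \<le> y k" by blast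
      obtain i j where ij: "i \<ge> k" "s i" "j \<ge> k" "\<not> s j" using ex_right ex_up by blast
      have "x k \<le> x i" "x (Suc i) \<le> x (max (Suc i) (Suc j))" "y k \<le> y j" "y (Suc j) \<le> y (max (Suc i) (Suc j))"
        using ij mono by (auto intro: monoD)
      then show ?case using k ij xS[of i] yS[of j] by (intro exI[of _ "max (Suc i) (Suc j)"]) auto
    qed auto
    from this[of "nat (b - x 0) + 1"] show "\<exists>k. b < x k" by (smt (verit) of_nat_1 of_nat_add nat_0_le of_nat_0_le_iff)
    from \<open>\<And>n. \<exists>k. x 0 + int n \<le> x k \<and> y 0 + int n \<le> y k\<close>[of "nat (b - y 0) + 1"]
    show "\<exists>k. b < y k" by (smt (verit) of_nat_1 of_nat_add nat_0_le of_nat_0_le_iff)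
  qed
  have big_x: "eventually (\<lambda>k. b < x k) sequentially" for b
    using unbounded(1)[of b] mono(1) unfolding eventually_sequentially by (meson less_le_trans monoD)
  have big_y: "eventually (\<lambda>k. b < y k) sequentially" for b
    using unbounded(2)[of b] mono(2) unfolding eventually_sequentially by (meson less_le_trans monoD)
  have lim_x: "filterlim (\<lambda>k. nat (x k)) at_top sequentially"
    unfolding filterlim_at_top
  proof
    fix Z :: nat
    show "eventually (\<lambda>k. Z \<le> nat (x k)) sequentially"
      using big_x[of "int Z"] by eventually_elim simp
  qed
  have lim_y: "filterlim (\<lambda>k. nat (y k)) at_top sequentially"
    unfolding filterlim_at_top
  proof
    fix Z :: nat
    show "eventually (\<lambda>k. Z \<le> nat (y k)) sequentially"
      using big_y[of "int Z"] by eventually_elim simp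
  qed
  have big_real_y: "eventually (\<lambda>k. c < y k) sequentially" for c :: real
    using big_y[of "\<lceil>c\<rceil>"] by eventually_elim linarith
  have pos: "eventually (\<lambda>k. 0 < x k \<and> 0 < y k) sequentially"
    using big_x[of 0] big_y[of 0] by eventually_elim simp
  have lx: "(\<lambda>k. ennreal (l (nat (x k)))) \<longlonglongrightarrow> r1" by (rule filterlim_compose[OF l(2) lim_x])
  have hy: "(\<lambda>k. ennreal (h (nat (y k)))) \<longlonglongrightarrow> r2" by (rule filterlim_compose[OF h(2) lim_y])
  have less_l: "eventually (\<lambda>k. c < l (nat (x k))) sequentially" if "ennreal c < r1" "0 < c" for c
    using order_tendstoD(1)[OF lx that(1)] by eventually_elim (use that in \<open>simp add: ennreal_less_iff\<close>)
  have less_h: "eventually (\<lambda>k. c < h (nat (y k))) sequentially" if "ennreal c < r2" "0 < c" for c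
    using order_tendstoD(1)[OF hy that(1)] by eventually_elim (use that in \<open>simp add: ennreal_less_iff\<close>)
  have l_less: "eventually (\<lambda>k. l (nat (x k)) < c) sequentially" if "r1 < ennreal c" "0 < c" for c
    using order_tendstoD(2)[OF lx that(1)] by eventually_elim (use that l in \<open>simp add: ennreal_less_iff less_imp_le\<close>)
  have h_less: "eventually (\<lambda>k. h (nat (y k)) < c) sequentially" if "r2 < ennreal c" "0 < c" for c
    using order_tendstoD(2)[OF hy that(1)] by eventually_elim (use that h in \<open>simp add: ennreal_less_iff less_imp_le\<close>)
  define u where "u = (\<lambda>k. ennreal (x k) / ennreal \<bar>y k\<bar>)"
  have le_u: "ennreal c \<le> u k \<longleftrightarrow> c * y k \<le> x k" and u_le: "u k \<le> ennreal c \<longleftrightarrow> x k \<le> c * y k"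
    if "0 < x k \<and> 0 < y k" "0 < c" for c :: real and k
    using ennreal_le_ratio[of "x k" "y k" c] ratio_le_ennreal[of "x k" "y k" c] that by (auto simp: u_def)
  have "seq_accumulation_points u = {r1..r2}"
  proof (rule seq_accumulation_points_interval)
    fix a assume "a < r1"
    then obtain c' where c': "0 < c'" "a < ennreal c'" "ennreal c' < r1" using ennreal_dense_real by blast
    then obtain c where c: "0 < c" "a < ennreal c" "ennreal c < ennreal c'" using ennreal_dense_real by blast
    then have cc: "c < c'" by (simp add: ennreal_less_iff)
    have "ennreal c' < r2" using c' assms by simp
    then have "eventually (\<lambda>k. (0 < x k \<and> 0 < y k) \<and> c' < l (nat (x k)) \<and> c' < h (nat (y k)) \<and> c / (c' - c) < y k) sequentially"
      using pos less_l[OF c'(3,1)] less_h[OF _ c'(1)] big_real_y by (simp add: eventually_conj_iff)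
    then obtain K where K: "\<And>k. k \<ge> K \<Longrightarrow> (0 < x k \<and> 0 < y k) \<and> c' < l (nat (x k)) \<and> c' < h (nat (y k)) \<and> c / (c' - c) < y k"
      unfolding eventually_sequentially by blast
    \<comment> \<open>An upward move is made only if the ratio is at least \<open>h\<close> (a
      rightward run has just ended) or above \<open>l\<close> (an upward run continues), hence at
      least \<open>c'\<close>. For large \<open>y\<close> a single move cannot take it from
      \<open>c'\<close> below \<open>c\<close>.\<close>
    have up: "c * y (Suc k) \<le> x (Suc k)" if k: "k > K" "\<not> s k" for k
    proof -
      obtain i where i: "k = Suc i" using k by (cases k) auto
      note Kk = K[of k, simplified]
      have "c' * y k \<le> x k"
      proof (cases "s i")
        case True
        then have "h (nat (y k)) * y k \<le> x k" using sS[of i] k i by simp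
        moreover have "c' * y k \<le> h (nat (y k)) * y k" using Kk k by (intro mult_right_mono) auto
        ultimately show ?thesis by simp
      next
        case False
        then have "l (nat (x k)) * y k \<le> x k" using sS[of i] k i by simp
        moreover have "c' * y k \<le> l (nat (x k)) * y k" using Kk k by (intro mult_right_mono) auto
        ultimately show ?thesis by simp
      qed
      moreover have "c < (c' - c) * y k" using Kk k cc by (simp add: field_simps)
      ultimately have "c * (y k + 1) \<le> x k" by (simp add: algebra_simps)
      then show ?thesis using k by (simp add: xS yS)
    qed
    obtain k1 where k1: "k1 > K" "\<not> s k1" using ex_up[of "Suc K"] Suc_le_lessD by blast
    \<comment> \<open>Upward moves establish the bound afresh, and rightward moves preserve
      it.\<close>
    have inv: "c * y k \<le> x k" if "k \<ge> Suc k1" for k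
      using that
    proof (induction rule: dec_induct)
      case base
      then show ?case using up k1 by blast
    next
      case (step k)
      then show ?case using up[of k] k1 by (cases "s k") (auto simp: xS yS)
    qed
    show "eventually (\<lambda>n. a < u n) sequentially"
      unfolding eventually_sequentially
    proof (intro exI allI impI)
      fix k assume k: "Suc k1 \<le> k"
      then have "ennreal c \<le> u k" using le_u[OF _ c(1), of k] inv K[of k] k1 by auto
      then show "a < u k" using c by order
    qed
  next
    fix b assume "r2 < b"
    then obtain c where c: "0 < c" "r2 < ennreal c" "ennreal c < b" using ennreal_dense_real by blast
    then obtain c' where c': "0 < c'" "r2 < ennreal c'" "ennreal c' < ennreal c" using ennreal_dense_real by blast
    then have cc: "c' < c" by (simp add: ennreal_less_iff)
    have "r1 < ennreal c'" using c' assms by simp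
    then have "eventually (\<lambda>k. (0 < x k \<and> 0 < y k) \<and> l (nat (x k)) < c' \<and> h (nat (y k)) < c' \<and> 1 / (c - c') < y k) sequentially"
      using pos l_less[OF _ c'(1)] h_less[OF c'(2,1)] big_real_y by (simp add: eventually_conj_iff)
    then obtain K where K: "\<And>k. k \<ge> K \<Longrightarrow> (0 < x k \<and> 0 < y k) \<and> l (nat (x k)) < c' \<and> h (nat (y k)) < c' \<and> 1 / (c - c') < y k"
      unfolding eventually_sequentially by blast
    \<comment> \<open>The mirror image of the previous case: before a rightward move the ratio is at
      most \<open>c'\<close>, and one unit of \<open>x\<close> is less than
      \<open>(c - c') * y\<close>.\<close>
    have right: "x (Suc k) \<le> c * y (Suc k)" if k: "k > K" "s k" for k
    proof -
      obtain i where i: "k = Suc i" using k by (cases k) auto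
      note Kk = K[of k, simplified]
      have "x k \<le> c' * y k"
      proof (cases "s i")
        case True
        then have "x k \<le> h (nat (y k)) * y k" using sS[of i] k i by simp
        moreover have "h (nat (y k)) * y k \<le> c' * y k" using Kk k by (intro mult_right_mono) auto
        ultimately show ?thesis by simp
      next
        case False
        then have "x k \<le> l (nat (x k)) * y k" using sS[of i] k i by simp
        moreover have "l (nat (x k)) * y k \<le> c' * y k" using Kk k by (intro mult_right_mono) auto
        ultimately show ?thesis by simp
      qed
      moreover have "1 < (c - c') * y k" using Kk k cc by (simp add: field_simps)
      ultimately have "x k + 1 \<le> c * y k" by (simp add: algebra_simps)
      then show ?thesis using k by (simp add: xS yS)
    qed
    obtain k1 where k1: "k1 > K" "s k1" using ex_right[of "Suc K"] Suc_le_lessD by blast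
    have inv: "x k \<le> c * y k" if "k \<ge> Suc k1" for k
      using that
    proof (induction rule: dec_induct)
      case base
      then show ?case using right k1 by blast
    next
      case (step k)
      then show ?case using right[of k] k1 c by (cases "s k") (auto simp: xS yS algebra_simps)
    qed
    show "eventually (\<lambda>n. u n < b) sequentially"
      unfolding eventually_sequentially
    proof (intro exI allI impI)
      fix k assume k: "Suc k1 \<le> k"
      then have "u k \<le> ennreal c" using u_le[OF _ c(1), of k] inv K[of k] k1 by auto
      then show "u k < b" using c by order
    qed
  next
    fix a k assume "a < r2"
    then obtain c where c: "0 < c" "a < ennreal c" "ennreal c < r2" using ennreal_dense_real by blast
    have "eventually (\<lambda>k. (0 < x k \<and> 0 < y k) \<and> c < h (nat (y k))) sequentially"
      using pos less_h[OF c(3,1)] by (simp add: eventually_conj_iff)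
    then obtain K where K: "\<And>k. k \<ge> K \<Longrightarrow> (0 < x k \<and> 0 < y k) \<and> c < h (nat (y k))"
      unfolding eventually_sequentially by blast
    obtain i j where ij: "i \<ge> max k K" "s i" "j \<ge> i" "\<not> s j" using ex_right ex_up by metis
    \<comment> \<open>At the end of a rightward run the ratio has reached \<open>h\<close>.\<close>
    obtain n where n: "n \<ge> i" "s n" "\<not> s (Suc n)" using exists_change[OF ij(3), of s] ij by blast
    have "h (nat (y (Suc n))) * y (Suc n) \<le> x (Suc n)" using sS[of n] n by simp
    moreover have "c * y (Suc n) \<le> h (nat (y (Suc n))) * y (Suc n)"
      using K[of "Suc n"] n ij by (intro mult_right_mono) auto
    ultimately have "c * y (Suc n) \<le> x (Suc n)" by linarith
    then have "ennreal c \<le> u (Suc n)" using le_u[OF _ c(1), of "Suc n"] K[of "Suc n"] n ij by auto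
    then have "a < u (Suc n)" using c by order
    then show "\<exists>n\<ge>k. a < u n" using n ij by (intro exI[of _ "Suc n"]) auto
  next
    fix b k assume "r1 < b"
    then obtain c where c: "0 < c" "r1 < ennreal c" "ennreal c < b" using ennreal_dense_real by blast
    have "eventually (\<lambda>k. (0 < x k \<and> 0 < y k) \<and> l (nat (x k)) < c) sequentially"
      using pos l_less[OF c(2,1)] by (simp add: eventually_conj_iff)
    then obtain K where K: "\<And>k. k \<ge> K \<Longrightarrow> (0 < x k \<and> 0 < y k) \<and> l (nat (x k)) < c"
      unfolding eventually_sequentially by blast
    obtain i j where ij: "i \<ge> max k K" "\<not> s i" "j \<ge> i" "s j" using ex_right ex_up by metis
    obtain n where n: "n \<ge> i" "\<not> s n" "s (Suc n)" using exists_change[OF ij(3), of "\<lambda>n. \<not> s n"] ij by blast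
    have "x (Suc n) \<le> l (nat (x (Suc n))) * y (Suc n)" using sS[of n] n by simp
    moreover have "l (nat (x (Suc n))) * y (Suc n) \<le> c * y (Suc n)"
      using K[of "Suc n"] n ij by (intro mult_right_mono) auto
    ultimately have "x (Suc n) \<le> c * y (Suc n)" by linarith
    then have "u (Suc n) \<le> ennreal c" using u_le[OF _ c(1), of "Suc n"] K[of "Suc n"] n ij by auto
    then have "u (Suc n) < b" using c by order
    then show "\<exists>n\<ge>k. u n < b" using n ij by (intro exI[of _ "Suc n"]) auto
  next
    fix a b :: ennreal assume "a < b"
    then obtain c where c: "0 < c" "a < ennreal c" "ennreal c < b" using ennreal_dense_real by blast
    then obtain c' where c': "0 < c'" "ennreal c < ennreal c'" "ennreal c' < b" using ennreal_dense_real by blast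
    then have cc: "c < c'" using c by (simp add: ennreal_less_iff)
    \<comment> \<open>A drop from \<open>c'\<close> to \<open>c\<close> in one move would require
      \<open>c' * y \<le> c * (y + 1)\<close>, which fails for large \<open>y\<close>.\<close>
    have "eventually (\<lambda>k. (0 < x k \<and> 0 < y k) \<and> c / (c' - c) < y k) sequentially"
      using pos big_real_y by (simp add: eventually_conj_iff)
    then show "eventually (\<lambda>n. \<not> (b \<le> u n \<and> u (Suc n) \<le> a)) sequentially"
    proof eventually_elim
      case (elim k)
      have pos': "0 < x (Suc k) \<and> 0 < y (Suc k)" using elim by (simp add: xS yS)
      show ?case
      proof
        assume ba: "b \<le> u k \<and> u (Suc k) \<le> a"
        then have "ennreal c' \<le> u k" "u (Suc k) \<le> ennreal c" using c c' by auto
        then have 1: "c' * y k \<le> x k" and 2: "x (Suc k) \<le> c * y (Suc k)"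
          using le_u[OF _ c'(1), of k] u_le[OF pos' c(1)] elim by auto
        have "x k \<le> x (Suc k)" by (simp add: xS)
        moreover have "c * y (Suc k) \<le> c * (y k + 1)" using c by (intro mult_left_mono) (auto simp: yS)
        moreover have "c < (c' - c) * y k" using elim cc by (simp add: field_simps)
        ultimately show False using 1 2 by (simp add: algebra_simps)
      qed
    qed
  qed
  then show ?thesis
    by (intro that[of s x y] init xS yS changes) (simp add: u_def)
qed

section \<open>Dense sets of rotations\<close>

lemma exists_odd_dyadic:
  fixes u v :: real
  assumes "u < v"
  obtains P :: int and Q :: nat where "odd P" "0 < Q" "coprime P (int Q)"
    "u < of_int P / real Q" "of_int P / real Q < v"
proof -
  obtain N where "3 / (v - u) < 2 ^ N" using real_arch_pow[of 2 "3 / (v - u)"] by auto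
  then have N: "3 < 2 ^ N * (v - u)" using assms by (simp add: field_simps)
  define P where "P = 2 * \<lfloor>2 ^ N * u / 2\<rfloor> + 3"
  have "2 ^ N * u < of_int P" "of_int P \<le> 2 ^ N * u + 3" unfolding P_def by linarith+
  moreover have "2 ^ N * u + 3 < 2 ^ N * v" using N by (simp add: algebra_simps)
  ultimately have "2 ^ N * u < of_int P" "of_int P < 2 ^ N * v" by linarith+
  then show ?thesis by (intro that[of P "2 ^ N"]) (auto simp: P_def field_simps)
qed

lemma stage_spans:
  assumes "\<alpha> \<notin> \<rat>" "stage s \<alpha> F m M"
  shows "spans \<alpha> (fst (snd F)) m M"
proof (cases F)
  case (fields P Q P' Q')
  show ?thesis
  proof (cases s)
    case True
    then show ?thesis using assms fields by (simp add: rising_def)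
  next
    case False
    then have sp: "spans (- \<alpha>) Q (2 - M) (2 - m)" using assms fields by (simp add: rising_def)
    have "- \<alpha> \<notin> \<rat>" using assms by simp
    then have "real i * - \<alpha> \<notin> \<int>" if "0 < i" for i
      using that by (rule irrational_multiple)
    from spans_uminus[OF this sp] have "spans (- (- \<alpha>)) Q (2 - (2 - m)) (2 - (2 - M))" .
    then show ?thesis using fields by simp
  qed
qed

text \<open>From \<open>K\<close> to \<open>L\<close> exactly one new value appears. At an
  intermediate time it either has or has not been attained.\<close>

lemma spans_between:
  assumes "spans \<alpha> K m M" "spans \<alpha> L m' M'" "K \<le> N" "N \<le> L"
    and "m' = m \<and> M' = M + 1 \<or> m' = m - 1 \<and> M' = M"
  shows "spans \<alpha> N m M \<or> spans \<alpha> N m' M'"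
proof -
  have "walk \<alpha> ` {1..N} \<subseteq> walk \<alpha> ` {1..L}" using assms(4) by (intro image_mono) auto
  then have sub: "walk \<alpha> ` {1..N} \<subseteq> {m'..M'}"
    using assms(2) unfolding spans_def by (meson order_trans)
  have "walk \<alpha> ` {1..K} \<subseteq> walk \<alpha> ` {1..N}" using assms(3) by (intro image_mono) auto
  then have mem: "{m, M} \<subseteq> walk \<alpha> ` {1..N}"
    using assms(1) unfolding spans_def by (meson order_trans)
  show ?thesis
  proof (cases "walk \<alpha> ` {1..N} \<subseteq> {m..M}")
    case True
    then show ?thesis using mem by (simp add: spans_def)
  next
    case False
    then obtain w where w: "w \<in> walk \<alpha> ` {1..N}" "w \<notin> {m..M}" by blast
    then have "w \<in> {m'..M'}" using sub by blast
    then have "m' = m \<and> M' = w \<or> m' = w \<and> M' = M" using w(2) assms(5) by auto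
    then have "{m', M'} \<subseteq> walk \<alpha> ` {1..N}" using mem w(1) by blast
    then show ?thesis using sub by (simp add: spans_def)
  qed
qed

lemma max_min_ratio_eq:
  assumes "spans (2 * \<theta>) (Suc n) m M"
  shows "max_min_ratio \<theta> (n + 2) = ennreal M / ennreal \<bar>m\<bar>"
proof -
  have set: "{1..<n + 2} = {1..Suc n}" by auto
  have img: "(\<lambda>i. rot_sum \<theta> i 0) ` {1..<n + 2} = real_of_int ` walk (2 * \<theta>) ` {1..Suc n}"
    unfolding set rot_sum_eq_walk image_image ..
  have "rot_max \<theta> (n + 2) 0 = of_int M"
    unfolding rot_max_def img by (rule Max_eqI) (use assms in \<open>auto simp: spans_def\<close>)
  moreover have "rot_min \<theta> (n + 2) 0 = of_int m"
    unfolding rot_min_def img by (rule Min_eqI) (use assms in \<open>auto simp: spans_def\<close>)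
  ultimately show ?thesis by (simp add: max_min_ratio_def)
qed

lemma exists_rotation_near:
  fixes r1 r2 :: ennreal and u v :: real
  assumes "r1 \<le> r2" "u < v"
  obtains \<theta> where "\<theta> \<notin> \<rat>" "u < \<theta>" "\<theta> < v"
    "seq_accumulation_points (\<lambda>n. max_min_ratio \<theta> (n + 2)) = {r1..r2}"
proof -
  obtain P :: int and Q :: nat where PQ: "odd P" "0 < Q" "coprime P (int Q)"
    and lim: "2 * u < of_int P / real Q" "of_int P / real Q < 2 * v"
    using exists_odd_dyadic[of "2 * u" "2 * v"] assms(2) by auto
  define \<epsilon> where "\<epsilon> = min (of_int P / real Q - 2 * u) (2 * v - of_int P / real Q)"
  have "0 < \<epsilon>" using lim by (simp add: \<epsilon>_def)
  obtain s0 F m M where F: "frame s0 F"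
    and ends: "of_int P / real Q - \<epsilon> < left_end s0 F" "right_end s0 F < of_int P / real Q + \<epsilon>"
    and start: "\<And>\<alpha>. left_end s0 F < \<alpha> \<Longrightarrow> \<alpha> < right_end s0 F \<Longrightarrow> stage s0 \<alpha> F m M"
    using exists_stage[OF PQ \<open>0 < \<epsilon>\<close>] by blast
  \<comment> \<open>The path coordinates stand for the maximum and the negated minimum of the
    walk.\<close>
  obtain s x y where init: "s 0 = s0" "x 0 = M" "y 0 = - m"
    and xS: "\<And>k. x (Suc k) = (if s k then x k + 1 else x k)"
    and yS: "\<And>k. y (Suc k) = (if s k then y k else y k + 1)"
    and changes: "\<And>k. \<exists>j\<ge>k. s (Suc j) \<noteq> s j"
    and acc: "seq_accumulation_points (\<lambda>k. ennreal (x k) / ennreal \<bar>y k\<bar>) = {r1..r2}"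
    using exists_lattice_path[OF assms(1)] by blast
  have F0: "frame (s 0) F" using F init by simp
  obtain \<alpha> where \<alpha>: "\<And>k. left_end (s k) (frames s F k) < \<alpha>" "\<And>k. \<alpha> < right_end (s k) (frames s F k)"
    using frames_limit[of s F, OF F0 changes] by blast
  have irr: "\<alpha> \<notin> \<rat>" by (rule irrational_if_in_frames[of s F, OF F0 \<alpha>])
  have stage: "stage (s k) \<alpha> (frames s F k) (- y k) (x k)" for k
  proof (induction k)
    case 0
    show ?case using start[of \<alpha>] \<alpha>[of 0] init by simp
  next
    case (Suc k)
    have "stage (s (Suc k)) \<alpha> (frames s F (Suc k)) (if s k then - y k else - y k - 1)
        (if s k then x k + 1 else x k)"
      using stage_advance[OF Suc irr] \<alpha>[of "Suc k"] by simp
    then show ?case by (simp add: xS yS split: if_splits)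
  qed
  define q where "q k = fst (snd (frames s F k))" for k
  have sp: "spans \<alpha> (q k) (- y k) (x k)" for k
    unfolding q_def using stage_spans[OF irr stage] .
  have fr: "frame (s k) (frames s F k)" for k
    by (induction k) (auto simp: F0 frame_advance simp del: frame.simps)
  have q: "0 < q k" "q k < q (Suc k)" for k
    using fr[of k] by (cases "frames s F k"; simp add: q_def)+
  define \<theta> where "\<theta> = \<alpha> / 2"
  have two: "2 * \<theta> = \<alpha>" by (simp add: \<theta>_def)
  have "seq_accumulation_points (\<lambda>n. max_min_ratio \<theta> (n + 2)) =
      seq_accumulation_points (\<lambda>k. ennreal (x k) / ennreal \<bar>y k\<bar>)"
  \<comment> \<open>The ratio at index \<open>n + 2\<close> involves the times up to
    \<open>n + 1\<close>, so denominator \<open>q k\<close> belongs to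
    \<open>n = q k - 1\<close>.\<close>
  proof (rule seq_accumulation_points_time_change[where N = "\<lambda>k. q k - 1"])
    show "strict_mono (\<lambda>k. q k - 1)"
      unfolding strict_mono_Suc_iff using q by (metis Suc_leI diff_less_mono One_nat_def)
  next
    fix k show "max_min_ratio \<theta> (q k - 1 + 2) = ennreal (x k) / ennreal \<bar>y k\<bar>"
      using max_min_ratio_eq[of \<theta> "q k - 1" "- y k" "x k"] sp q(1)[of k] by (simp add: two)
  next
    fix k n assume "q k - 1 \<le> n" "n \<le> q (Suc k) - 1"
    then have "q k \<le> Suc n" "Suc n \<le> q (Suc k)" using q(1)[of k] q(1)[of "Suc k"] by auto
    then have "spans \<alpha> (Suc n) (- y k) (x k) \<or> spans \<alpha> (Suc n) (- y (Suc k)) (x (Suc k))"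
      by (intro spans_between[OF sp sp]) (auto simp: xS yS)
    then show "max_min_ratio \<theta> (n + 2) = ennreal (x k) / ennreal \<bar>y k\<bar> \<or>
        max_min_ratio \<theta> (n + 2) = ennreal (x (Suc k)) / ennreal \<bar>y (Suc k)\<bar>"
      using max_min_ratio_eq[of \<theta> n, unfolded two] by fastforce
  qed
  moreover have "\<theta> \<notin> \<rat>"
  proof
    assume "\<theta> \<in> \<rat>"
    then have "2 * \<theta> \<in> \<rat>" by (intro Rats_mult) auto
    then show False using irr two by simp
  qed
  moreover have "u < \<theta>" "\<theta> < v"
    using \<alpha>[of 0] ends init by (auto simp: \<theta>_def \<epsilon>_def)
  ultimately show ?thesis using that acc by simp
qed

theorem theorem1p3:
  fixes r1 r2 :: ennreal
  assumes "0 \<le> r1" and "r1 \<le> r2" and "r2 \<le> \<infinity>"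
  shows "\<exists>D :: real set. D \<subseteq> {0<..<1} - \<rat> \<and> {0<..<1} \<subseteq> closure D \<and>
    (\<forall>\<theta>\<in>D. seq_accumulation_points (\<lambda>n. max_min_ratio \<theta> (n + 2)) = {r1..r2})"
proof -
  \<comment> \<open>With all suitable angles collected in \<open>D\<close>, only density remains to
    be shown.\<close>
  define D where "D = {\<theta> \<in> {0<..<1} - \<rat>.
    seq_accumulation_points (\<lambda>n. max_min_ratio \<theta> (n + 2)) = {r1..r2}}"
  have "t \<in> closure D" if t: "t \<in> {0<..<1}" for t
    unfolding closure_approachable
  proof (intro allI impI)
    fix e :: real assume "0 < e"
    then have "max 0 (t - e) < min 1 (t + e)" using t by auto
    then obtain \<theta> where "\<theta> \<notin> \<rat>" "max 0 (t - e) < \<theta>" "\<theta> < min 1 (t + e)"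
      "seq_accumulation_points (\<lambda>n. max_min_ratio \<theta> (n + 2)) = {r1..r2}"
      using exists_rotation_near[OF assms(2)] by blast
    then show "\<exists>\<theta>\<in>D. dist \<theta> t < e"
      by (intro bexI[of _ \<theta>]) (auto simp: D_def dist_real_def)
  qed
  then show ?thesis by (intro exI[of _ D]) (auto simp: D_def)
qed

end
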